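(* Let $\theta\in\Lambda_\infty(n)$ and $\beta\in(\Lambda_\infty(n))'$. The Toeplitz operator $T_{\theta,\beta}:\Lambda_\infty(n)\to\Lambda_\infty(n)$ is (i) strongly tame, and hence m-topologizable, if $\sum_{n=1}^\infty|\beta_{n-1}|<\infty$; (ii) power bounded if $\sup_{p\in\mathbb{N}}\|\theta\|_p+\sum_{n\in\mathbb{N}}|\beta_{n-1}|\le1$.
   Context: $\mathbb{N}=\{1,2,\dots\}$, $\mathbb{N}_0=\mathbb{N}\cup\{0\}$. $\Lambda_\infty(n)=\{x=(x_n)_{n\in\mathbb{N}}:\|x\|_k:=\sum_{n=1}^\infty|x_n|e^{kn}<\infty\text{ for all }k\in\mathbb{N}\}$, a Fréchet space with seminorms $(\|\cdot\|_k)_{k\in\mathbb{N}}$ and canonical basis $(e_n)_{n\in\mathbb{N}}$. Symbols are indexed from $0$, with $\theta_{n-1}$ (resp. $\beta_{n-1}$) the $n$-th coordinate: $\theta=(\theta_n)_{n\in\mathbb{N}_0}\in\Lambda_\infty(n)$ with $\|\theta\|_k=\sum_{n=1}^\infty|\theta_{n-1}|e^{kn}$, and $\beta=(\beta_n)_{n\in\mathbb{N}_0}\in(\Lambda_\infty(n))'$ means that $|\beta_{n-1}|\le Ce^{mn}$ for all $n\in\mathbb{N}$, for some $m\in\mathbb{N}$, $C>0$. Define the linear operators $\widehat{T}_\theta e_n=\sum_{j=n}^\infty\theta_{j-n}e_j$ and $\check{T}_\beta e_n=\sum_{j=1}^n\beta_{n-j}e_j$, extended by $Tx=\sum_{n=1}^\infty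 x_nTe_n$ (both are well-defined and continuous on $\Lambda_\infty(n)$), and the Toeplitz operator $T_{\theta,\beta}=\widehat{T}_\theta+\check{T}_\beta$. A linear operator $T$ on a Fréchet space $E$ with increasing seminorms $(\|\cdot\|_p)_{p\in\mathbb{N}}$ is strongly tame if for every $p\in\mathbb{N}$ there is $C_p>0$ with $\|Tx\|_p\le C_p\|x\|_p$ for all $x\in E$; a continuous linear $T$ is m-topologizable if for every $p\in\mathbb{N}$ there exist $q\in\mathbb{N}$ and $C_p\ge1$ with $\|T^kx\|_p\le C_p^k\|x\|_q$ for all $k\in\mathbb{N}$, $x\in E$; it is power bounded if for every $p\in\mathbb{N}$ there exist $q\in\mathbb{N}$ and $C_p\ge1$ with $\|T^kx\|_p\le C_p\|x\|_q$ for all $k\in\mathbb{N}$, $x\in E$. *)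

theory Defs
  imports "HOL-Analysis.Analysis"
begin

text \<open>
  The scalar field is any complete real normed field, so that the real and the complex case are
  both covered.  A sequence of scalars is a function on \<^typ>\<open>nat\<close>; the \<open>n\<close>-th coordinate
  (\<open>n = 1, 2, \<dots>\<close>) is stored at index \<open>n - 1\<close>, which is the indexing of the symbols \<open>\<theta>\<close> and \<open>\<beta>\<close>.
  Accordingly the weight \<open>exp (k n)\<close> appears as \<open>exp (k * Suc n)\<close>.  The seminorms are numbered by
  \<open>k \<ge> 1\<close>; the value \<open>k = 0\<close> is never used.
\<close>

type_synonym 'a seq = "nat \<Rightarrow> 'a"

definition Lambda_inf :: "'a::{real_normed_field,banach} seq set" where
  "Lambda_inf = {x. \<forall>k\<ge>1. summable (\<lambda>n. norm (x n) * exp (real k * real (Suc n)))}"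

definition Lambda_norm :: "nat \<Rightarrow> 'a::{real_normed_field,banach} seq \<Rightarrow> real" where
  "Lambda_norm k x = (\<Sum>n. norm (x n) * exp (real k * real (Suc n)))"

definition Lambda_inf_dual :: "'a::{real_normed_field,banach} seq set" where
  "Lambda_inf_dual =
     {\<beta>. \<exists>m\<ge>1. \<exists>C>0. \<forall>n. norm (\<beta> n) \<le> C * exp (real (m::nat) * real (Suc n))}"


text \<open>
  Operators on a sequence space \<open>E\<close> carrying a sequence \<open>nrm 1, nrm 2, \<dots>\<close> of seminorms.  The
  locally convex topology is generated by the balls of the single seminorms.
\<close>

definition seminorm_topology ::
  "'a::{real_normed_field,banach} seq set \<Rightarrow> (nat \<Rightarrow> 'a seq \<Rightarrow> real) \<Rightarrow> 'a seq topology" where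
  "seminorm_topology E nrm = topology_generated_by
     {{y \<in> E. nrm k (\<lambda>i. y i - x i) < r} | k x r. k \<ge> 1 \<and> x \<in> E \<and> r > 0}"

definition linear_operator ::
  "'a::{real_normed_field,banach} seq set \<Rightarrow> ('a seq \<Rightarrow> 'a seq) \<Rightarrow> bool" where
  "linear_operator E T \<longleftrightarrow>
     (\<forall>x\<in>E. T x \<in> E) \<and>
     (\<forall>x\<in>E. \<forall>y\<in>E. T (\<lambda>i. x i + y i) = (\<lambda>i. T x i + T y i)) \<and>
     (\<forall>c. \<forall>x\<in>E. T (\<lambda>i. c * x i) = (\<lambda>i. c * T x i))"

definition continuous_operator ::
  "'a::{real_normed_field,banach} seq set \<Rightarrow> (nat \<Rightarrow> 'a seq \<Rightarrow> real) \<Rightarrow> ('a seq \<Rightarrow> 'a seq) \<Rightarrow> bool"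
  where
  "continuous_operator E nrm T \<longleftrightarrow>
     linear_operator E T \<and> continuous_map (seminorm_topology E nrm) (seminorm_topology E nrm) T"

definition strongly_tame ::
  "'a::{real_normed_field,banach} seq set \<Rightarrow> (nat \<Rightarrow> 'a seq \<Rightarrow> real) \<Rightarrow> ('a seq \<Rightarrow> 'a seq) \<Rightarrow> bool"
  where
  "strongly_tame E nrm T \<longleftrightarrow>
     linear_operator E T \<and>
     (\<forall>p\<ge>1. \<exists>C>0. \<forall>x\<in>E. nrm p (T x) \<le> C * nrm p x)"

definition m_topologizable ::
  "'a::{real_normed_field,banach} seq set \<Rightarrow> (nat \<Rightarrow> 'a seq \<Rightarrow> real) \<Rightarrow> ('a seq \<Rightarrow> 'a seq) \<Rightarrow> bool"
  where
  "m_topologizable E nrm T \<longleftrightarrow>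
     continuous_operator E nrm T \<and>
     (\<forall>p\<ge>1. \<exists>q\<ge>1. \<exists>C\<ge>1. \<forall>k\<ge>1. \<forall>x\<in>E. nrm p ((T ^^ k) x) \<le> C ^ k * nrm q x)"

definition power_bounded ::
  "'a::{real_normed_field,banach} seq set \<Rightarrow> (nat \<Rightarrow> 'a seq \<Rightarrow> real) \<Rightarrow> ('a seq \<Rightarrow> 'a seq) \<Rightarrow> bool"
  where
  "power_bounded E nrm T \<longleftrightarrow>
     continuous_operator E nrm T \<and>
     (\<forall>p\<ge>1. \<exists>q\<ge>1. \<exists>C\<ge>1. \<forall>k\<ge>1. \<forall>x\<in>E. nrm p ((T ^^ k) x) \<le> C * nrm q x)"


text \<open>The sum of a series of sequences, convergent in the topology of \<^const>\<open>Lambda_inf\<close>.\<close>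

definition Lambda_suminf :: "(nat \<Rightarrow> 'a::{real_normed_field,banach} seq) \<Rightarrow> 'a seq" where
  "Lambda_suminf f =
     (THE y. limitin (seminorm_topology Lambda_inf Lambda_norm)
               (\<lambda>N i. \<Sum>n<N. f n i) y sequentially)"

definition unit_seq :: "nat \<Rightarrow> 'a::{real_normed_field,banach} seq" where
  "unit_seq n = (\<lambda>i. if i = n then 1 else 0)"

text \<open>The operator \<open>x \<mapsto> \<Sum>n. x\<^sub>n (T e\<^sub>n)\<close> determined by the images \<open>A n = T e\<^sub>n\<close> of the basis.\<close>

definition extend_basis ::
  "(nat \<Rightarrow> 'a::{real_normed_field,banach} seq) \<Rightarrow> 'a seq \<Rightarrow> 'a seq" where
  "extend_basis A x = Lambda_suminf (\<lambda>n i. x n * A n i)"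

definition toeplitz_hat :: "'a::{real_normed_field,banach} seq \<Rightarrow> 'a seq \<Rightarrow> 'a seq" where
  "toeplitz_hat \<theta> = extend_basis
     (\<lambda>n. Lambda_suminf (\<lambda>j i. if n \<le> j then \<theta> (j - n) * unit_seq j i else 0))"

definition toeplitz_check :: "'a::{real_normed_field,banach} seq \<Rightarrow> 'a seq \<Rightarrow> 'a seq" where
  "toeplitz_check \<beta> = extend_basis (\<lambda>n i. \<Sum>j\<le>n. \<beta> (n - j) * unit_seq j i)"

definition toeplitz ::
  "'a::{real_normed_field,banach} seq \<Rightarrow> 'a seq \<Rightarrow> 'a seq \<Rightarrow> 'a seq" where
  "toeplitz \<theta> \<beta> x = (\<lambda>i. toeplitz_hat \<theta> x i + toeplitz_check \<beta> x i)"

end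

theory Submission
  imports Defs
begin

text \<open>
  An operator that is determined by the images \<open>A n\<close> of the basis vectors inherits every seminorm
  bound that holds on the basis: \<open>x\<close> is the absolutely convergent sum of the \<open>x n \<cdot> e\<^sub>n\<close>, and
  \<open>\<parallel>x\<parallel>\<^sub>k\<close> is exactly the sum of the \<open>|x n| \<parallel>e\<^sub>n\<parallel>\<^sub>k\<close>.  Hence \<open>\<parallel>A n\<parallel>\<^sub>k \<le> C k \<parallel>e\<^sub>n\<parallel>\<^sub>k\<close> for all \<open>n\<close>
  gives \<open>\<parallel>T x\<parallel>\<^sub>k \<le> C k \<parallel>x\<parallel>\<^sub>k\<close>, with no change of the index \<open>k\<close> (\<open>Lambda_norm_extend_basis\<close>).

  So it suffices to estimate the columns of the Toeplitz matrix.  The weight \<open>\<parallel>e\<^sub>n\<parallel>\<^sub>k\<close> is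
  submultiplicative in \<open>n\<close>, which bounds the \<open>n\<close>-th column of the lower triangular part, a shift of
  \<open>\<theta>\<close>, by \<open>\<parallel>\<theta>\<parallel>\<^sub>k \<parallel>e\<^sub>n\<parallel>\<^sub>k\<close>.  The weight is increasing in \<open>n\<close>, which bounds the \<open>n\<close>-th column of the
  upper triangular part, a reversed initial segment of \<open>\<beta>\<close> supported on the indices up to \<open>n\<close>, by
  \<open>(\<Sum>|\<beta>|) \<parallel>e\<^sub>n\<parallel>\<^sub>k\<close>.  Together these give the single estimate that carries both parts
  (\<open>Lambda_norm_toeplitz\<close>):
  \<open>\<parallel>T x\<parallel>\<^sub>k \<le> (\<parallel>\<theta>\<parallel>\<^sub>k + \<Sum>|\<beta>|) \<parallel>x\<parallel>\<^sub>k\<close>.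

  This is strong tameness.  Since the same seminorm stands on both sides, the estimate iterates to
  \<open>\<parallel>T\<^sup>j x\<parallel>\<^sub>k \<le> C\<^sup>j \<parallel>x\<parallel>\<^sub>k\<close>, which is m-topologizability.  If the constants are at most \<open>1\<close>, every
  power of \<open>T\<close> is a contraction for every seminorm, which is power boundedness.

  The operators are defined by sums that converge in the topology of the sequence space, so the
  estimates presuppose that such sums can be computed: absolute convergence in every seminorm implies
  convergence, and the limit is the coordinatewise sum (\<open>Lambda_suminf_eq\<close>).
\<close>

section \<open>The weights and the seminorms\<close>

text \<open>The value \<open>wt k n\<close> is the \<open>k\<close>-th seminorm of the basis vector stored at index \<open>n\<close>.\<close>

definition wt :: "nat \<Rightarrow> nat \<Rightarrow> real" where
  "wt k n = exp (real k * real (Suc n))"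

lemma wt_pos [simp]: "wt k n > 0"
  by (simp add: wt_def)

lemma wt_nonneg [simp]: "wt k n \<ge> 0"
  by (simp add: less_imp_le)

lemma wt_ge_1: "wt k n \<ge> 1"
  unfolding wt_def by (rule one_le_exp_iff[THEN iffD2]) simp

lemma wt_mono: "m \<le> n \<Longrightarrow> wt k m \<le> wt k n"
  by (simp add: wt_def mult_left_mono)

text \<open>
  The indexing from \<open>0\<close> makes this an inequality: the exponents are \<open>k (m + n + 1)\<close> and
  \<open>k (m + n + 2)\<close>.
\<close>

lemma wt_shift: "wt k (m + n) \<le> wt k m * wt k n"
  unfolding wt_def exp_add[symmetric] by (simp add: algebra_simps)

lemma Lambda_inf_iff: "x \<in> Lambda_inf \<longleftrightarrow> (\<forall>k\<ge>1. summable (\<lambda>n. norm (x n) * wt k n))"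
  by (simp add: Lambda_inf_def wt_def)

lemma Lambda_norm_eq: "Lambda_norm k x = (\<Sum>n. norm (x n) * wt k n)"
  by (simp add: Lambda_norm_def wt_def)

lemma Lambda_summable: "x \<in> Lambda_inf \<Longrightarrow> k \<ge> 1 \<Longrightarrow> summable (\<lambda>n. norm (x n) * wt k n)"
  by (simp add: Lambda_inf_iff)

lemma Lambda_norm_nonneg:
  assumes "x \<in> Lambda_inf" "k \<ge> 1"
  shows "0 \<le> Lambda_norm k x"
  unfolding Lambda_norm_eq by (intro suminf_nonneg Lambda_summable assms) simp

text \<open>
  Since all weights are at least \<open>1\<close>, each seminorm dominates the coordinates.  This is why limits are
  unique and why they can be computed coordinatewise.
\<close>

lemma norm_coordinate_le:
  assumes "x \<in> Lambda_inf" "k \<ge> 1"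
  shows "norm (x i) \<le> Lambda_norm k x"
proof -
  have "norm (x i) \<le> norm (x i) * wt k i"
    using mult_left_mono[OF wt_ge_1, of "norm (x i)"] by simp
  also have "\<dots> = (\<Sum>n\<in>{i}. norm (x n) * wt k n)" by simp
  also have "\<dots> \<le> Lambda_norm k x"
    unfolding Lambda_norm_eq by (rule sum_le_suminf[OF Lambda_summable[OF assms]]) auto
  finally show ?thesis .
qed

lemma Lambda_zero: "(\<lambda>i. 0) \<in> Lambda_inf"
  by (simp add: Lambda_inf_iff)

lemma Lambda_add:
  assumes "x \<in> Lambda_inf" "y \<in> Lambda_inf"
  shows "(\<lambda>i. x i + y i) \<in> Lambda_inf"
  unfolding Lambda_inf_iff
proof (intro allI impI)
  fix k :: nat assume k: "k \<ge> 1"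
  show "summable (\<lambda>n. norm (x n + y n) * wt k n)"
    by (rule summable_comparison_test'[OF summable_add[OF assms[THEN Lambda_summable[OF _ k]]]])
      (simp add: distrib_right[symmetric] mult_right_mono norm_triangle_ineq abs_mult)
qed

lemma Lambda_norm_triangle:
  assumes "x \<in> Lambda_inf" "y \<in> Lambda_inf" "k \<ge> 1"
  shows "Lambda_norm k (\<lambda>i. x i + y i) \<le> Lambda_norm k x + Lambda_norm k y"
  unfolding Lambda_norm_eq
  by (subst suminf_add, (intro Lambda_summable assms)+,
      rule suminf_le, simp add: distrib_right[symmetric] mult_right_mono norm_triangle_ineq,
      (intro Lambda_summable Lambda_add summable_add assms)+)

lemma Lambda_scale: "x \<in> Lambda_inf \<Longrightarrow> (\<lambda>i. c * x i) \<in> Lambda_inf"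
  by (simp add: Lambda_inf_iff norm_mult mult.assoc summable_mult)

lemma Lambda_norm_scale:
  assumes "x \<in> Lambda_inf" "k \<ge> 1"
  shows "Lambda_norm k (\<lambda>i. c * x i) = norm c * Lambda_norm k x"
  unfolding Lambda_norm_eq
  using suminf_mult[OF Lambda_summable[OF assms], of "norm c"] by (simp add: norm_mult mult.assoc)

lemma Lambda_diff:
  assumes "x \<in> Lambda_inf" "y \<in> Lambda_inf"
  shows "(\<lambda>i. x i - y i) \<in> Lambda_inf"
  using Lambda_add[OF assms(1) Lambda_scale[OF assms(2), of "-1"]] by simp

lemma Lambda_norm_diff_triangle:
  assumes "x \<in> Lambda_inf" "y \<in> Lambda_inf" "z \<in> Lambda_inf" "k \<ge> 1"
  shows "Lambda_norm k (\<lambda>i. x i - z i) \<le>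
    Lambda_norm k (\<lambda>i. x i - y i) + Lambda_norm k (\<lambda>i. y i - z i)"
  using Lambda_norm_triangle[OF Lambda_diff[OF assms(1,2)] Lambda_diff[OF assms(2,3)] assms(4)]
  by simp

lemma Lambda_norm_minus: "Lambda_norm k (\<lambda>i. x i - y i) = Lambda_norm k (\<lambda>i. y i - x i)"
  by (simp add: Lambda_norm_eq norm_minus_commute)

lemma Lambda_sum:
  assumes "\<And>n. n \<in> M \<Longrightarrow> f n \<in> Lambda_inf"
  shows "(\<lambda>i. \<Sum>n\<in>M. f n i) \<in> Lambda_inf"
  using assms
  by (induction M rule: infinite_finite_induct) (auto simp: Lambda_zero intro: Lambda_add)

lemma Lambda_norm_sum_le:
  assumes "\<And>n. n \<in> M \<Longrightarrow> f n \<in> Lambda_inf" "k \<ge> 1"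
  shows "Lambda_norm k (\<lambda>i. \<Sum>n\<in>M. f n i) \<le> (\<Sum>n\<in>M. Lambda_norm k (f n))"
  using assms(1)
proof (induction M rule: infinite_finite_induct)
  case (insert a M)
  then have "f a \<in> Lambda_inf" "(\<lambda>i. \<Sum>n\<in>M. f n i) \<in> Lambda_inf"
    by (auto intro: Lambda_sum)
  from Lambda_norm_triangle[OF this assms(2)] insert show ?case by simp
qed (simp_all add: Lambda_norm_eq)

section \<open>Limits in the seminorm topology\<close>

abbreviation Lambda_top :: "'a::{real_normed_field,banach} seq topology" where
  "Lambda_top \<equiv> seminorm_topology Lambda_inf Lambda_norm"

lemma openin_ball:
  "k \<ge> 1 \<Longrightarrow> x \<in> Lambda_inf \<Longrightarrow> r > 0 \<Longrightarrow>
    openin Lambda_top {y \<in> Lambda_inf. Lambda_norm k (\<lambda>i. y i - x i) < r}"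
  unfolding seminorm_topology_def by (rule topology_generated_by_Basis) blast

lemma topspace_Lambda:
  "topspace Lambda_top = (Lambda_inf :: 'a::{real_normed_field,banach} seq set)"
proof
  show "topspace Lambda_top \<subseteq> (Lambda_inf :: 'a seq set)"
    unfolding seminorm_topology_def topology_generated_by_topspace by blast
  show "(Lambda_inf :: 'a seq set) \<subseteq> topspace Lambda_top"
  proof
    fix x :: "'a seq" assume x: "x \<in> Lambda_inf"
    then have "x \<in> {y \<in> Lambda_inf. Lambda_norm 1 (\<lambda>i. y i - x i) < 1}"
      by (simp add: Lambda_norm_eq)
    then show "x \<in> topspace Lambda_top"
      using openin_subset[OF openin_ball[OF order_refl x zero_less_one]] by blast
  qed
qed

text \<open>
  The balls around all points form only a subbase, so an open set is handled by induction on its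
  generation.  For a ball that contains \<open>l\<close> without being centred there, the triangle inequality
  leaves a smaller ball around \<open>l\<close> inside it.
\<close>

lemma limitin_LambdaI:
  assumes f: "\<And>N. f N \<in> Lambda_inf" and l: "l \<in> Lambda_inf"
    and lim: "\<And>k. k \<ge> 1 \<Longrightarrow> (\<lambda>N. Lambda_norm k (\<lambda>i. f N i - l i)) \<longlonglongrightarrow> 0"
  shows "limitin Lambda_top f l sequentially"
proof -
  have "\<forall>\<^sub>F N in sequentially. f N \<in> U"
    if "generate_topology_on {{y \<in> Lambda_inf. Lambda_norm k (\<lambda>i. y i - x i) < r} | k x r.
          k \<ge> 1 \<and> x \<in> Lambda_inf \<and> r > 0} U" "l \<in> U" for U
    using that
  proof induction
    case Empty
    then show ?case by simp
  next
    case (Int a b)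
    then show ?case by (auto intro: eventually_conj)
  next
    case (UN K)
    then obtain V where "V \<in> K" "\<forall>\<^sub>F N in sequentially. f N \<in> V" by auto
    then show ?case by (auto elim: eventually_mono)
  next
    case (Basis B)
    then obtain k x r where B: "B = {y \<in> Lambda_inf. Lambda_norm k (\<lambda>i. y i - x i) < r}"
      and k: "k \<ge> 1" and x: "x \<in> Lambda_inf" by blast
    have "Lambda_norm k (\<lambda>i. l i - x i) < r" using Basis.prems B by simp
    then have "\<forall>\<^sub>F N in sequentially.
        Lambda_norm k (\<lambda>i. f N i - l i) < r - Lambda_norm k (\<lambda>i. l i - x i)"
      by (intro order_tendstoD(2)[OF lim[OF k]]) simp
    then show ?case
    proof (rule eventually_mono)
      fix N
      assume "Lambda_norm k (\<lambda>i. f N i - l i) < r - Lambda_norm k (\<lambda>i. l i - x i)"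
      then show "f N \<in> B"
        unfolding B using Lambda_norm_diff_triangle[OF f l x k, of N] f by simp
    qed
  qed
  then show ?thesis
    unfolding limitin_def topspace_Lambda
    using l by (simp add: seminorm_topology_def openin_topology_generated_by_iff)
qed

text \<open>
  Only the first seminorm enters, because it already controls every coordinate.
\<close>

lemma limitin_LambdaD:
  assumes "limitin Lambda_top f l sequentially" "\<epsilon> > 0"
  shows "\<forall>\<^sub>F N in sequentially. norm (f N i - l i) < \<epsilon>"
proof -
  have l: "l \<in> Lambda_inf" using assms(1) by (simp add: limitin_def topspace_Lambda)
  have "l \<in> {y \<in> Lambda_inf. Lambda_norm 1 (\<lambda>i. y i - l i) < \<epsilon>}"
    using l assms(2) by (simp add: Lambda_norm_eq)
  then have "\<forall>\<^sub>F N in sequentially.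
      f N \<in> {y \<in> Lambda_inf. Lambda_norm 1 (\<lambda>i. y i - l i) < \<epsilon>}"
    using assms(1) openin_ball[OF order_refl l assms(2)] unfolding limitin_def by blast
  then show ?thesis
    by (rule eventually_mono)
      (use norm_coordinate_le[OF Lambda_diff[OF _ l], of _ 1 i] in \<open>auto intro: le_less_trans\<close>)
qed

lemma limitin_Lambda_unique:
  assumes "limitin Lambda_top f l sequentially" "limitin Lambda_top f l' sequentially"
  shows "l = l'"
proof
  fix i
  have "(\<lambda>N. f N i) \<longlonglongrightarrow> l i" "(\<lambda>N. f N i) \<longlonglongrightarrow> l' i"
    unfolding tendsto_iff dist_norm using limitin_LambdaD assms by blast+
  then show "l i = l' i" by (rule LIMSEQ_unique)
qed

section \<open>Absolutely convergent series of sequences\<close>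

text \<open>
  The interchange of the two infinite sums is reduced to finite ones: for each \<open>I\<close>, the first \<open>I\<close>
  coordinates of the sum contribute at most the total of the seminorms, because a finite sum
  may be exchanged with a series.  The series over the coordinates has nonnegative terms, so these
  bounds on its partial sums give convergence and the same bound for its value.
\<close>

lemma
  fixes f :: "nat \<Rightarrow> 'a::{real_normed_field,banach} seq"
  assumes f: "\<And>n. f n \<in> Lambda_inf" and k: "k \<ge> 1" and S: "summable (\<lambda>n. Lambda_norm k (f n))"
  shows summable_coordinate: "summable (\<lambda>n. norm (f n i))"
    and summable_coordinatewise: "summable (\<lambda>i. norm (\<Sum>n. f n i) * wt k i)"
    and Lambda_norm_coordinatewise: "Lambda_norm k (\<lambda>i. \<Sum>n. f n i) \<le> (\<Sum>n. Lambda_norm k (f n))"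
proof -
  show *: "summable (\<lambda>n. norm (f n i))" for i
    by (rule summable_comparison_test'[OF S]) (use norm_coordinate_le[OF f k] in simp)
  have partial: "(\<Sum>i<I. norm (\<Sum>n. f n i) * wt k i) \<le> (\<Sum>n. Lambda_norm k (f n))" for I
  proof -
    have "(\<Sum>i<I. norm (\<Sum>n. f n i) * wt k i) \<le> (\<Sum>i<I. \<Sum>n. norm (f n i) * wt k i)"
    proof (rule sum_mono)
      fix i
      show "norm (\<Sum>n. f n i) * wt k i \<le> (\<Sum>n. norm (f n i) * wt k i)"
        using mult_right_mono[OF summable_norm[OF *] wt_nonneg] by (simp add: suminf_mult2 *)
    qed
    also have "\<dots> = (\<Sum>n. \<Sum>i<I. norm (f n i) * wt k i)"
      by (rule suminf_sum[symmetric]) (intro summable_mult2 *)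
    also have "\<dots> \<le> (\<Sum>n. Lambda_norm k (f n))"
    proof (rule suminf_le[OF _ _ S])
      show "(\<Sum>i<I. norm (f n i) * wt k i) \<le> Lambda_norm k (f n)" for n
        unfolding Lambda_norm_eq by (rule sum_le_suminf[OF Lambda_summable[OF f k]]) auto
      show "summable (\<lambda>n. \<Sum>i<I. norm (f n i) * wt k i)"
        by (intro summable_sum summable_mult2 *)
    qed
    finally show ?thesis .
  qed
  show **: "summable (\<lambda>i. norm (\<Sum>n. f n i) * wt k i)"
    by (rule summableI_nonneg_bounded[OF _ partial]) simp
  show "Lambda_norm k (\<lambda>i. \<Sum>n. f n i) \<le> (\<Sum>n. Lambda_norm k (f n))"
    unfolding Lambda_norm_eq[of k "\<lambda>i. \<Sum>n. f n i"] by (rule suminf_le_const[OF ** partial])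
qed

text \<open>
  The previous estimate is used twice: for the whole series it shows that the coordinatewise sum lies
  in the space, and for the tails, which are again such series, it shows that the remainders tend to
  \<open>0\<close> in each seminorm.
\<close>

lemma
  fixes f :: "nat \<Rightarrow> 'a::{real_normed_field,banach} seq"
  assumes f: "\<And>n. f n \<in> Lambda_inf" and S: "\<And>k. k \<ge> 1 \<Longrightarrow> summable (\<lambda>n. Lambda_norm k (f n))"
  shows Lambda_suminf_eq: "Lambda_suminf f = (\<lambda>i. \<Sum>n. f n i)"
    and Lambda_suminf_in: "Lambda_suminf f \<in> Lambda_inf"
    and Lambda_norm_suminf_le: "k \<ge> 1 \<Longrightarrow> Lambda_norm k (Lambda_suminf f) \<le> (\<Sum>n. Lambda_norm k (f n))"
proof -
  define y where "y = (\<lambda>i. \<Sum>n. f n i)"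
  have y: "y \<in> Lambda_inf"
    unfolding Lambda_inf_iff y_def using summable_coordinatewise[OF f _ S] by blast
  have "limitin Lambda_top (\<lambda>N i. \<Sum>n<N. f n i) y sequentially"
  proof (rule limitin_LambdaI[OF Lambda_sum[OF f] y])
    fix k :: nat assume k: "k \<ge> 1"
    have bound: "Lambda_norm k (\<lambda>i. (\<Sum>n<N. f n i) - y i) \<le> (\<Sum>n. Lambda_norm k (f (n + N)))" for N
    proof -
      have "y i - (\<Sum>n<N. f n i) = (\<Sum>n. f (n + N) i)" for i
        unfolding y_def
        using suminf_minus_initial_segment[OF summable_norm_cancel[OF summable_coordinate[OF f k S[OF k]]], of N i]
        by simp
      then have "Lambda_norm k (\<lambda>i. (\<Sum>n<N. f n i) - y i) = Lambda_norm k (\<lambda>i. \<Sum>n. f (n + N) i)"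
        by (subst Lambda_norm_minus) simp
      also have "\<dots> \<le> (\<Sum>n. Lambda_norm k (f (n + N)))"
        by (rule Lambda_norm_coordinatewise[OF f k]) (rule summable_ignore_initial_segment[OF S[OF k]])
      finally show ?thesis .
    qed
    have nonneg: "0 \<le> Lambda_norm k (\<lambda>i. (\<Sum>n<N. f n i) - y i)" for N
      by (intro Lambda_norm_nonneg Lambda_diff Lambda_sum f y k)
    have "(\<lambda>N. \<Sum>n. Lambda_norm k (f (n + N))) \<longlonglongrightarrow> 0"
      by (rule suminf_exist_split2[OF S[OF k]])
    then show "(\<lambda>N. Lambda_norm k (\<lambda>i. (\<Sum>n<N. f n i) - y i)) \<longlonglongrightarrow> 0"
      by (rule tendsto_sandwich[OF always_eventually always_eventually tendsto_const, rotated 2])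
        (use bound nonneg in auto)
  qed
  then have eq: "Lambda_suminf f = y"
    unfolding Lambda_suminf_def using limitin_Lambda_unique by (intro the_equality) auto
  then show "Lambda_suminf f = (\<lambda>i. \<Sum>n. f n i)" "Lambda_suminf f \<in> Lambda_inf"
    using y y_def by auto
  show "Lambda_norm k (Lambda_suminf f) \<le> (\<Sum>n. Lambda_norm k (f n))" if "k \<ge> 1"
    unfolding eq y_def by (rule Lambda_norm_coordinatewise[OF f that S[OF that]])
qed

section \<open>Operators given by their columns\<close>

text \<open>
  The hypothesis on the columns compares \<open>\<parallel>A n\<parallel>\<^sub>k\<close> with the same seminorm of the basis vector, so
  \<open>\<parallel>x n \<cdot> A n\<parallel>\<^sub>k\<close> is at most \<open>C k\<close> times the \<open>n\<close>-th term of the series for \<open>\<parallel>x\<parallel>\<^sub>k\<close>.  Summation over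
  \<open>n\<close> gives convergence as well as the bound.
\<close>

lemma
  fixes A :: "nat \<Rightarrow> 'a::{real_normed_field,banach} seq"
  assumes A: "\<And>n. A n \<in> Lambda_inf"
    and C: "\<And>k n. k \<ge> 1 \<Longrightarrow> Lambda_norm k (A n) \<le> C k * wt k n"
  shows linear_extend_basis: "linear_operator Lambda_inf (extend_basis A)"
    and Lambda_norm_extend_basis:
      "k \<ge> 1 \<Longrightarrow> x \<in> Lambda_inf \<Longrightarrow> Lambda_norm k (extend_basis A x) \<le> C k * Lambda_norm k x"
proof -
  have term_le: "Lambda_norm k (\<lambda>i. x n * A n i) \<le> C k * (norm (x n) * wt k n)"
    if "k \<ge> 1" for k n and x :: "'a seq"
    using mult_left_mono[OF C[OF that], of "norm (x n)" n] Lambda_norm_scale[OF A that]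
    by (simp add: mult_ac)
  have summ: "summable (\<lambda>n. Lambda_norm k (\<lambda>i. x n * A n i))"
    if "k \<ge> 1" "x \<in> Lambda_inf" for k and x :: "'a seq"
    by (rule summable_comparison_test'[OF summable_mult[OF Lambda_summable[OF that(2,1)], of "C k"]])
      (use term_le[OF that(1)] Lambda_norm_nonneg[OF Lambda_scale[OF A] that(1)] in simp)
  have eq: "extend_basis A x = (\<lambda>i. \<Sum>n. x n * A n i)" if "x \<in> Lambda_inf" for x
    unfolding extend_basis_def by (rule Lambda_suminf_eq[OF Lambda_scale[OF A] summ[OF _ that]])
  have coord: "summable (\<lambda>n. x n * A n i)" if "x \<in> Lambda_inf" for x i
    by (rule summable_norm_cancel,
        rule summable_coordinate[OF Lambda_scale[OF A] _ summ[OF _ that], of 1]) auto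
  show "linear_operator Lambda_inf (extend_basis A)"
    unfolding linear_operator_def
  proof (intro conjI ballI allI)
    fix x y :: "'a seq" and c assume x: "x \<in> Lambda_inf"
    show "extend_basis A x \<in> Lambda_inf"
      unfolding extend_basis_def by (rule Lambda_suminf_in[OF Lambda_scale[OF A] summ[OF _ x]])
    show "extend_basis A (\<lambda>i. c * x i) = (\<lambda>i. c * extend_basis A x i)"
      by (simp add: eq x Lambda_scale mult.assoc suminf_mult coord)
    assume y: "y \<in> Lambda_inf"
    show "extend_basis A (\<lambda>i. x i + y i) = (\<lambda>i. extend_basis A x i + extend_basis A y i)"
      by (simp add: eq x y Lambda_add distrib_right suminf_add[symmetric] coord)
  qed
  assume k: "k \<ge> 1" and x: "x \<in> Lambda_inf"
  have "Lambda_norm k (extend_basis A x) \<le> (\<Sum>n. Lambda_norm k (\<lambda>i. x n * A n i))"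
    unfolding extend_basis_def
    by (rule Lambda_norm_suminf_le[OF Lambda_scale[OF A] summ[OF _ x] k])
  also have "\<dots> \<le> (\<Sum>n. C k * (norm (x n) * wt k n))"
    by (intro suminf_le term_le summ k x summable_mult Lambda_summable)
  also have "\<dots> = C k * Lambda_norm k x"
    unfolding Lambda_norm_eq by (rule suminf_mult[OF Lambda_summable[OF x k]])
  finally show "Lambda_norm k (extend_basis A x) \<le> C k * Lambda_norm k x" .
qed

lemma
  shows Lambda_single: "(\<lambda>i. c * unit_seq j i) \<in> Lambda_inf"
    and Lambda_norm_single: "Lambda_norm k (\<lambda>i. c * unit_seq j i) = norm c * wt k j"
proof -
  have "(\<lambda>n. norm (c * unit_seq j n) * wt k n) sums (\<Sum>n\<in>{j}. norm (c * unit_seq j n) * wt k n)" for k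
    by (rule sums_finite) (auto simp: unit_seq_def)
  then have "(\<lambda>n. norm (c * unit_seq j n) * wt k n) sums (norm c * wt k j)" for k
    by (simp add: unit_seq_def)
  then show "(\<lambda>i. c * unit_seq j i) \<in> Lambda_inf"
    "Lambda_norm k (\<lambda>i. c * unit_seq j i) = norm c * wt k j"
    unfolding Lambda_inf_iff Lambda_norm_eq by (auto simp: sums_iff)
qed

section \<open>Toeplitz operators\<close>

text \<open>
  The \<open>n\<close>-th column is \<open>\<theta>\<close> shifted down by \<open>n\<close> places, so its norm is the sum of the
  \<open>|\<theta> m| wt k (m + n)\<close>; submultiplicativity of the weight splits off the factor \<open>wt k n\<close>.
\<close>

lemma
  assumes \<theta>: "\<theta> \<in> Lambda_inf"
  shows linear_toeplitz_hat: "linear_operator Lambda_inf (toeplitz_hat \<theta>)"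
    and Lambda_norm_toeplitz_hat: "k \<ge> 1 \<Longrightarrow> x \<in> Lambda_inf \<Longrightarrow>
      Lambda_norm k (toeplitz_hat \<theta> x) \<le> Lambda_norm k \<theta> * Lambda_norm k x"
proof -
  define f where "f = (\<lambda>n j i. if n \<le> j then \<theta> (j - n) * unit_seq j i else 0)"
  have f_eq: "f n j = (\<lambda>i. (if n \<le> j then \<theta> (j - n) else 0) * unit_seq j i)" for n j
    by (auto simp: f_def)
  have f: "f n j \<in> Lambda_inf" for n j
    unfolding f_eq by (rule Lambda_single)
  have f_norm: "Lambda_norm k (f n j) = (if n \<le> j then norm (\<theta> (j - n)) * wt k j else 0)" for k n j
    unfolding f_eq Lambda_norm_single by simp
  have dom: "summable (\<lambda>m. norm (\<theta> m) * wt k m * wt k n)" if "k \<ge> 1" for k n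
    by (intro summable_mult2 Lambda_summable \<theta> that)
  have shift: "norm (\<theta> m) * wt k (m + n) \<le> norm (\<theta> m) * wt k m * wt k n" for k m n
    using mult_left_mono[OF wt_shift, of "norm (\<theta> m)"] by (simp add: mult.assoc)
  have shift_summ: "summable (\<lambda>m. norm (\<theta> m) * wt k (m + n))" if "k \<ge> 1" for k n
    by (rule summable_comparison_test'[OF dom[OF that, of n]]) (use shift in simp)
  have summ: "summable (\<lambda>j. Lambda_norm k (f n j))" if "k \<ge> 1" for k n
    by (subst summable_iff_shift[of _ n, symmetric]) (simp add: f_norm shift_summ[OF that])
  have bound: "Lambda_norm k (Lambda_suminf (f n)) \<le> Lambda_norm k \<theta> * wt k n" if k: "k \<ge> 1" for k n
  proof -
    have "Lambda_norm k (Lambda_suminf (f n)) \<le> (\<Sum>j. Lambda_norm k (f n j))"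
      by (rule Lambda_norm_suminf_le[OF f summ k])
    also have "\<dots> = (\<Sum>m. norm (\<theta> m) * wt k (m + n))"
      using suminf_split_initial_segment[OF summ[OF k], of n n] by (simp add: f_norm)
    also have "\<dots> \<le> (\<Sum>m. norm (\<theta> m) * wt k m * wt k n)"
      by (rule suminf_le[OF shift shift_summ[OF k] dom[OF k]])
    also have "\<dots> = Lambda_norm k \<theta> * wt k n"
      unfolding Lambda_norm_eq by (rule suminf_mult2[OF Lambda_summable[OF \<theta> k], symmetric])
    finally show ?thesis .
  qed
  have eq: "toeplitz_hat \<theta> = extend_basis (\<lambda>n. Lambda_suminf (f n))"
    by (simp add: toeplitz_hat_def f_def)
  note A = Lambda_suminf_in[of "f n" for n, OF f summ]
  show "linear_operator Lambda_inf (toeplitz_hat \<theta>)"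
    unfolding eq by (rule linear_extend_basis[OF A bound])
  show "Lambda_norm k (toeplitz_hat \<theta> x) \<le> Lambda_norm k \<theta> * Lambda_norm k x"
    if "k \<ge> 1" "x \<in> Lambda_inf"
    unfolding eq by (rule Lambda_norm_extend_basis[OF A bound that])
qed

text \<open>
  The \<open>n\<close>-th column is supported on the indices \<open>j \<le> n\<close>, where the weight is at most \<open>wt k n\<close>; what
  remains is a partial sum of the \<open>|\<beta> j|\<close> in reversed order.
\<close>

lemma
  assumes \<beta>: "summable (\<lambda>n. norm (\<beta> n))"
  shows linear_toeplitz_check: "linear_operator Lambda_inf (toeplitz_check \<beta>)"
    and Lambda_norm_toeplitz_check: "k \<ge> 1 \<Longrightarrow> x \<in> Lambda_inf \<Longrightarrow>
      Lambda_norm k (toeplitz_check \<beta> x) \<le> (\<Sum>n. norm (\<beta> n)) * Lambda_norm k x"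
proof -
  define A where "A = (\<lambda>n i. \<Sum>j\<le>n. \<beta> (n - j) * unit_seq j i)"
  have A: "A n \<in> Lambda_inf" for n
    unfolding A_def by (intro Lambda_sum Lambda_single)
  have bound: "Lambda_norm k (A n) \<le> (\<Sum>n. norm (\<beta> n)) * wt k n" if k: "k \<ge> 1" for k n
  proof -
    have "Lambda_norm k (A n) \<le> (\<Sum>j\<le>n. norm (\<beta> (n - j)) * wt k j)"
      unfolding A_def using Lambda_norm_sum_le[OF Lambda_single k, where M = "{..n}"]
      by (simp add: Lambda_norm_single)
    also have "\<dots> \<le> (\<Sum>j\<le>n. norm (\<beta> (n - j)) * wt k n)"
      by (intro sum_mono mult_left_mono wt_mono) auto
    also have "\<dots> = (\<Sum>j\<le>n. norm (\<beta> j)) * wt k n"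
      unfolding sum_distrib_right
      by (rule sum.reindex_bij_witness[of _ "\<lambda>j. n - j" "\<lambda>j. n - j"]) auto
    also have "\<dots> \<le> (\<Sum>n. norm (\<beta> n)) * wt k n"
      by (intro mult_right_mono sum_le_suminf \<beta>) auto
    finally show ?thesis .
  qed
  have eq: "toeplitz_check \<beta> = extend_basis A"
    by (simp add: toeplitz_check_def A_def)
  show "linear_operator Lambda_inf (toeplitz_check \<beta>)"
    unfolding eq by (rule linear_extend_basis[OF A bound])
  show "Lambda_norm k (toeplitz_check \<beta> x) \<le> (\<Sum>n. norm (\<beta> n)) * Lambda_norm k x"
    if "k \<ge> 1" "x \<in> Lambda_inf"
    unfolding eq by (rule Lambda_norm_extend_basis[OF A bound that])
qed

lemma
  assumes \<theta>: "\<theta> \<in> Lambda_inf" and \<beta>: "summable (\<lambda>n. norm (\<beta> n))"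
  shows linear_toeplitz: "linear_operator Lambda_inf (toeplitz \<theta> \<beta>)"
    and Lambda_norm_toeplitz: "k \<ge> 1 \<Longrightarrow> x \<in> Lambda_inf \<Longrightarrow>
      Lambda_norm k (toeplitz \<theta> \<beta> x) \<le> (Lambda_norm k \<theta> + (\<Sum>n. norm (\<beta> n))) * Lambda_norm k x"
proof -
  note hat = linear_toeplitz_hat[OF \<theta>, unfolded linear_operator_def]
  note check = linear_toeplitz_check[OF \<beta>, unfolded linear_operator_def]
  show "linear_operator Lambda_inf (toeplitz \<theta> \<beta>)"
    using hat check unfolding linear_operator_def toeplitz_def
    by (auto simp: algebra_simps intro: Lambda_add)
  assume k: "k \<ge> 1" and x: "x \<in> Lambda_inf"
  have "Lambda_norm k (toeplitz \<theta> \<beta> x) \<le>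
      Lambda_norm k (toeplitz_hat \<theta> x) + Lambda_norm k (toeplitz_check \<beta> x)"
    unfolding toeplitz_def using Lambda_norm_triangle hat check x k by blast
  then show "Lambda_norm k (toeplitz \<theta> \<beta> x) \<le>
      (Lambda_norm k \<theta> + (\<Sum>n. norm (\<beta> n))) * Lambda_norm k x"
    using Lambda_norm_toeplitz_hat[OF \<theta> k x] Lambda_norm_toeplitz_check[OF \<beta> k x]
    by (simp add: distrib_right)
qed

section \<open>Continuity and powers of strongly tame operators\<close>

text \<open>
  It suffices to look at the preimage of a ball of the subbase.  Around each of its points \<open>y\<close> it
  contains a ball of the same seminorm; the radius is the slack at \<open>T y\<close>, divided by the tameness
  constant.
\<close>

lemma strongly_tame_imp_continuous:
  fixes T :: "'a::{real_normed_field,banach} seq \<Rightarrow> 'a seq"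
  assumes "strongly_tame Lambda_inf Lambda_norm T"
  shows "continuous_operator Lambda_inf Lambda_norm T"
proof -
  have lin: "linear_operator Lambda_inf T" using assms by (simp add: strongly_tame_def)
  have T: "T x \<in> Lambda_inf" if "x \<in> Lambda_inf" for x
    using lin that by (simp add: linear_operator_def)
  have Tdiff: "T (\<lambda>i. y i - z i) = (\<lambda>i. T y i - T z i)" if "y \<in> Lambda_inf" "z \<in> Lambda_inf" for y z
  proof -
    have add: "T (\<lambda>i. u i + v i) = (\<lambda>i. T u i + T v i)"
      if "u \<in> Lambda_inf" "v \<in> Lambda_inf" for u v
      using lin that by (simp add: linear_operator_def)
    have scale: "T (\<lambda>i. - 1 * z i) = (\<lambda>i. - 1 * T z i)"
      using lin that(2) unfolding linear_operator_def by blast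
    show ?thesis
      using add[OF that(1) Lambda_scale[OF that(2), of "-1"]] scale by simp
  qed
  have pre: "openin Lambda_top {z \<in> Lambda_inf. T z \<in> {y \<in> Lambda_inf. Lambda_norm k (\<lambda>i. y i - x i) < r}}"
    (is "openin _ ?P")
    if k: "k \<ge> 1" and x: "x \<in> Lambda_inf" for k r x
  proof (subst openin_subopen, intro ballI)
    fix y assume "y \<in> ?P"
    then have y: "y \<in> Lambda_inf" and yr: "Lambda_norm k (\<lambda>i. T y i - x i) < r" by auto
    obtain C where C: "C > 0" "\<And>z. z \<in> Lambda_inf \<Longrightarrow> Lambda_norm k (T z) \<le> C * Lambda_norm k z"
      using assms k unfolding strongly_tame_def by blast
    define \<delta> where "\<delta> = (r - Lambda_norm k (\<lambda>i. T y i - x i)) / C"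
    have \<delta>: "\<delta> > 0" using yr C(1) by (simp add: \<delta>_def)
    let ?B = "{z \<in> Lambda_inf. Lambda_norm k (\<lambda>i. z i - y i) < \<delta>}"
    have "?B \<subseteq> ?P"
    proof
      fix z assume "z \<in> ?B"
      then have z: "z \<in> Lambda_inf" and zd: "Lambda_norm k (\<lambda>i. z i - y i) < \<delta>" by auto
      have "Lambda_norm k (\<lambda>i. T z i - T y i) \<le> C * Lambda_norm k (\<lambda>i. z i - y i)"
        using C(2)[OF Lambda_diff[OF z y]] Tdiff[OF z y] by simp
      also have "\<dots> < C * \<delta>" using zd C(1) by simp
      also have "\<dots> = r - Lambda_norm k (\<lambda>i. T y i - x i)" using C(1) by (simp add: \<delta>_def)
      finally have "Lambda_norm k (\<lambda>i. T z i - x i) < r"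
        using Lambda_norm_diff_triangle[OF T[OF z] T[OF y] x k] by simp
      then show "z \<in> ?P" using z T by simp
    qed
    moreover have "y \<in> ?B" using y \<delta> by (simp add: Lambda_norm_eq)
    ultimately show "\<exists>B. openin Lambda_top B \<and> y \<in> B \<and> B \<subseteq> ?P"
      using openin_ball[OF k y \<delta>] by blast
  qed
  let ?S = "{{y \<in> Lambda_inf. Lambda_norm k (\<lambda>i. y i - x i) < r} | k x r.
    k \<ge> 1 \<and> x \<in> (Lambda_inf :: 'a seq set) \<and> r > 0}"
  have "continuous_map Lambda_top (topology_generated_by ?S) T"
  proof (rule continuous_on_generated_topo)
    fix U assume "U \<in> ?S"
    then obtain k x r where U: "U = {y \<in> Lambda_inf. Lambda_norm k (\<lambda>i. y i - x i) < r}"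
      and "k \<ge> 1" "x \<in> Lambda_inf" by blast
    moreover have "T -` U \<inter> topspace Lambda_top = {z \<in> Lambda_inf. T z \<in> U}"
      unfolding topspace_Lambda by blast
    ultimately show "openin Lambda_top (T -` U \<inter> topspace Lambda_top)"
      using pre by simp
  next
    have "\<Union> ?S = Lambda_inf"
      using topspace_Lambda unfolding seminorm_topology_def topology_generated_by_topspace .
    then show "T ` topspace Lambda_top \<subseteq> \<Union> ?S"
      using T by (auto simp: topspace_Lambda)
  qed
  then have "continuous_map Lambda_top Lambda_top T"
    unfolding seminorm_topology_def .
  then show ?thesis using lin by (simp add: continuous_operator_def)
qed

lemma Lambda_norm_funpow_le:
  fixes T :: "'a::{real_normed_field,banach} seq \<Rightarrow> 'a seq"
  assumes T: "\<And>x. x \<in> Lambda_inf \<Longrightarrow> T x \<in> Lambda_inf"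
    and C: "C \<ge> 0" "\<And>x. x \<in> Lambda_inf \<Longrightarrow> Lambda_norm p (T x) \<le> C * Lambda_norm p x"
    and x: "x \<in> Lambda_inf"
  shows "Lambda_norm p ((T ^^ k) x) \<le> C ^ k * Lambda_norm p x"
proof (induction k)
  case (Suc k)
  have "(T ^^ k) x \<in> Lambda_inf" by (induction k) (simp_all add: T x)
  then have "Lambda_norm p ((T ^^ Suc k) x) \<le> C * Lambda_norm p ((T ^^ k) x)"
    using C(2) by simp
  also have "\<dots> \<le> C * (C ^ k * Lambda_norm p x)" by (rule mult_left_mono[OF Suc C(1)])
  finally show ?case by (simp add: mult.assoc)
qed simp

text \<open>
  The constant is enlarged to be at least \<open>1\<close>, as the definition of m-topologizability demands.
\<close>

lemma strongly_tame_imp_m_topologizable: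
  assumes "strongly_tame Lambda_inf Lambda_norm T"
  shows "m_topologizable Lambda_inf Lambda_norm T"
  unfolding m_topologizable_def
proof (intro conjI strongly_tame_imp_continuous[OF assms] allI impI)
  fix p :: nat assume p: "p \<ge> 1"
  have T: "T x \<in> Lambda_inf" if "x \<in> Lambda_inf" for x
    using assms that by (simp add: strongly_tame_def linear_operator_def)
  obtain C where C: "\<And>x. x \<in> Lambda_inf \<Longrightarrow> Lambda_norm p (T x) \<le> C * Lambda_norm p x"
    using assms p unfolding strongly_tame_def by blast
  have "Lambda_norm p (T x) \<le> max 1 C * Lambda_norm p x" if "x \<in> Lambda_inf" for x
    using C[OF that] mult_right_mono[OF max.cobounded2 Lambda_norm_nonneg[OF that p], of C 1] by simp
  then show "\<exists>q\<ge>1. \<exists>C\<ge>1. \<forall>k\<ge>1. \<forall>x\<in>Lambda_inf. Lambda_norm p ((T ^^ k) x) \<le> C ^ k * Lambda_norm q x"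
    using p T Lambda_norm_funpow_le[of T "max 1 C" p]
    by (intro exI[of _ p] conjI exI[of _ "max 1 C"]) auto
qed

lemma contraction_imp_power_bounded:
  assumes T: "linear_operator Lambda_inf T"
    and le: "\<And>p x. p \<ge> 1 \<Longrightarrow> x \<in> Lambda_inf \<Longrightarrow> Lambda_norm p (T x) \<le> Lambda_norm p x"
  shows "power_bounded Lambda_inf Lambda_norm T"
  unfolding power_bounded_def
proof (intro conjI allI impI)
  have "strongly_tame Lambda_inf Lambda_norm T"
    unfolding strongly_tame_def using T le by (auto intro!: exI[of _ 1])
  then show "continuous_operator Lambda_inf Lambda_norm T" by (rule strongly_tame_imp_continuous)
  fix p :: nat assume p: "p \<ge> 1"
  have "Lambda_norm p ((T ^^ k) x) \<le> 1 * Lambda_norm p x" if "x \<in> Lambda_inf" for k x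
    using Lambda_norm_funpow_le[of T 1 p x k] T le p that by (simp add: linear_operator_def)
  then show "\<exists>q\<ge>1. \<exists>C\<ge>1. \<forall>k\<ge>1. \<forall>x\<in>Lambda_inf. Lambda_norm p ((T ^^ k) x) \<le> C * Lambda_norm q x"
    using p by (intro exI[of _ p] exI[of _ 1]) auto
qed

section \<open>Strong tameness and power boundedness\<close>

theorem proposition6p5:
  fixes \<theta> \<beta> :: "'a::{real_normed_field,banach} seq"
  assumes "\<theta> \<in> Lambda_inf" and "\<beta> \<in> Lambda_inf_dual"
  shows "(summable (\<lambda>n. norm (\<beta> n)) \<longrightarrow>
           strongly_tame Lambda_inf Lambda_norm (toeplitz \<theta> \<beta>) \<and>
           m_topologizable Lambda_inf Lambda_norm (toeplitz \<theta> \<beta>)) \<and>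
         ((SUP p\<in>{1..}. ennreal (Lambda_norm p \<theta>)) + (\<Sum>n. ennreal (norm (\<beta> n))) \<le> 1 \<longrightarrow>
           power_bounded Lambda_inf Lambda_norm (toeplitz \<theta> \<beta>))"
proof (intro conjI impI)
  assume \<beta>: "summable (\<lambda>n. norm (\<beta> n))"
  show "strongly_tame Lambda_inf Lambda_norm (toeplitz \<theta> \<beta>)"
    unfolding strongly_tame_def
  proof (intro conjI allI impI linear_toeplitz assms \<beta>)
    fix p :: nat assume p: "p \<ge> 1"
    let ?C = "Lambda_norm p \<theta> + (\<Sum>n. norm (\<beta> n))"
    have "?C \<ge> 0"
      using Lambda_norm_nonneg[OF assms(1) p] suminf_nonneg[OF \<beta>] by simp
    moreover have "Lambda_norm p (toeplitz \<theta> \<beta> x) \<le> (?C + 1) * Lambda_norm p x"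
      if "x \<in> Lambda_inf" for x
      using Lambda_norm_toeplitz[OF assms(1) \<beta> p that] Lambda_norm_nonneg[OF that p]
      by (simp add: distrib_right)
    \<comment> \<open>For \<open>\<theta> = \<beta> = 0\<close> the constant \<open>?C\<close> vanishes; adding \<open>1\<close> makes it positive.\<close>
    ultimately show "\<exists>C>0. \<forall>x\<in>Lambda_inf. Lambda_norm p (toeplitz \<theta> \<beta> x) \<le> C * Lambda_norm p x"
      by (intro exI[of _ "?C + 1"]) auto
  qed
  then show "m_topologizable Lambda_inf Lambda_norm (toeplitz \<theta> \<beta>)"
    by (rule strongly_tame_imp_m_topologizable)
next
  assume le: "(SUP p\<in>{1..}. ennreal (Lambda_norm p \<theta>)) + (\<Sum>n. ennreal (norm (\<beta> n))) \<le> 1"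
  have "(\<Sum>n. ennreal (norm (\<beta> n))) \<le> 1"
    using le by (rule order_trans[rotated]) simp
  then have \<beta>: "summable (\<lambda>n. norm (\<beta> n))"
    by (intro summable_suminf_not_top) (auto simp: top_unique)
  show "power_bounded Lambda_inf Lambda_norm (toeplitz \<theta> \<beta>)"
  proof (rule contraction_imp_power_bounded[OF linear_toeplitz[OF assms(1) \<beta>]])
    fix p :: nat and x :: "'a seq" assume p: "p \<ge> 1" and x: "x \<in> Lambda_inf"
    have "ennreal (Lambda_norm p \<theta> + (\<Sum>n. norm (\<beta> n))) =
        ennreal (Lambda_norm p \<theta>) + (\<Sum>n. ennreal (norm (\<beta> n)))"
      by (simp add: Lambda_norm_nonneg[OF assms(1) p] suminf_nonneg \<beta> suminf_ennreal2)
    also have "\<dots> \<le> (SUP p\<in>{1..}. ennreal (Lambda_norm p \<theta>)) + (\<Sum>n. ennreal (norm (\<beta> n)))"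
      by (intro add_right_mono SUP_upper) (use p in simp)
    also note le
    finally have "Lambda_norm p \<theta> + (\<Sum>n. norm (\<beta> n)) \<le> 1" by simp
    then have "(Lambda_norm p \<theta> + (\<Sum>n. norm (\<beta> n))) * Lambda_norm p x \<le> Lambda_norm p x"
      using Lambda_norm_nonneg[OF x p] by (metis mult_right_mono mult_1)
    then show "Lambda_norm p (toeplitz \<theta> \<beta> x) \<le> Lambda_norm p x"
      using Lambda_norm_toeplitz[OF assms(1) \<beta> p x] by simp
  qed
qed

end
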